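(* Let $P$ be a poset on a nonempty finite set $K$ with $|K|=k$, let $d'(P)=\max\{d(P|_A)\mid A\subsetneq K\}$ and $\varepsilon(P)=d'(P)/d(P)$. Then $d'(P)\le 2^{k-1}$, $\varepsilon(P)<1$, and for every positive integer $m$ $$0\le r(m,P):=d(P)^m-e(m,P)\le 2^{m(P)-1}d'(P)^m\le 2^{(k-1)(m+1)},$$ so that $e(m,P)=d(P)^m\bigl(1-O(\varepsilon(P)^m)\bigr)$ as $m\to\infty$; in particular $e(m,P)$ is asymptotically equal to $d(P)^m$.
   Context: $d(\cdot)$ is the number of downsets of a finite poset, $P|_A$ the induced subposet on $A$, $m(P)$ the number of minimal elements of $P$. For a finite poset $P$ on $K$ and a finite set $M$ disjoint from $K$ with $|M|=m$, $e(m,P)$ is the number of partial orders on $M\cup K$ inducing $P$ on $K$ whose set of minimal elements is exactly $M$. *)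

theory Defs
  imports "HOL-Library.Landau_Symbols"
begin

text \<open>
  A poset on a carrier \<open>K\<close> is given by its reflexive order relation \<open>P\<close>, where \<open>(x, y) \<in> P\<close>
  means \<open>x \<le> y\<close> and \<open>partial_order_on K P\<close> holds (which includes \<open>P \<subseteq> K \<times> K\<close>).
  The induced subposet on \<open>A\<close> is \<open>Restr P A\<close>.
\<close>

definition downsets :: "'a set \<Rightarrow> 'a rel \<Rightarrow> 'a set set" where
  "downsets K P = {D. D \<subseteq> K \<and> (\<forall>y\<in>D. \<forall>x\<in>K. (x, y) \<in> P \<longrightarrow> x \<in> D)}"

definition num_downsets :: "'a set \<Rightarrow> 'a rel \<Rightarrow> nat" where
  "num_downsets K P = card (downsets K P)"

definition minimal_elements :: "'a set \<Rightarrow> 'a rel \<Rightarrow> 'a set" where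
  "minimal_elements K P = {x \<in> K. \<forall>y\<in>K. (y, x) \<in> P \<longrightarrow> y = x}"

definition num_minimal :: "'a set \<Rightarrow> 'a rel \<Rightarrow> nat" where
  "num_minimal K P = card (minimal_elements K P)"

definition max_proper_downsets :: "'a set \<Rightarrow> 'a rel \<Rightarrow> nat" where
  "max_proper_downsets K P = Max {num_downsets A (Restr P A) | A. A \<subset> K}"

definition downset_ratio :: "'a set \<Rightarrow> 'a rel \<Rightarrow> real" where
  "downset_ratio K P = real (max_proper_downsets K P) / real (num_downsets K P)"

definition extensions :: "'a set \<Rightarrow> 'a set \<Rightarrow> 'a rel \<Rightarrow> 'a rel set" where
  "extensions M K P =
     {R. partial_order_on (M \<union> K) R \<and> Restr R K = P \<and> minimal_elements (M \<union> K) R = M}"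

text \<open>
  The number \<open>e(m, P)\<close>. Since the type \<open>'a\<close> need not contain \<open>m\<close> elements outside \<open>K\<close>, the
  disjoint sets \<open>M\<close> and \<open>K\<close> are realised in the sum type \<open>'a + nat\<close>; by
  \<open>num_extensions_eq\<close> below, any other \<open>m\<close>-element set \<open>M\<close> disjoint from \<open>K\<close> gives the
  same number.
\<close>

definition num_extensions :: "nat \<Rightarrow> 'a set \<Rightarrow> 'a rel \<Rightarrow> nat" where
  "num_extensions m K P =
     card (extensions (Inr ` {..<m} :: ('a + nat) set) (Inl ` K) (map_prod Inl Inl ` P))"

definition extension_deficit :: "nat \<Rightarrow> 'a set \<Rightarrow> 'a rel \<Rightarrow> int" where
  "extension_deficit m K P = int (num_downsets K P) ^ m - int (num_extensions m K P)"

lemma extensions_subset: "R \<in> extensions M K P \<Longrightarrow> R \<subseteq> (M \<union> K) \<times> (M \<union> K)"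
  by (simp add: extensions_def partial_order_onD(4))

lemma extensions_image:
  assumes inj: "inj_on f (M \<union> K)" and P: "P \<subseteq> K \<times> K" and R: "R \<in> extensions M K P"
  shows "map_prod f f ` R \<in> extensions (f ` M) (f ` K) (map_prod f f ` P)"
proof -
  let ?S = "map_prod f f ` R"
  have po: "partial_order_on (M \<union> K) R" and rs: "Restr R K = P"
    and mn: "minimal_elements (M \<union> K) R = M"
    using R by (auto simp: extensions_def)
  have sub: "R \<subseteq> (M \<union> K) \<times> (M \<union> K)" and rf: "refl_on (M \<union> K) R"
    and tr: "trans R" and an: "antisym R"
    using partial_order_onD[OF po] by auto
  have iff: "(f x, f y) \<in> ?S \<longleftrightarrow> (x, y) \<in> R" if "x \<in> M \<union> K" "y \<in> M \<union> K" for x y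
  proof
    assume "(f x, f y) \<in> ?S"
    then obtain a b where ab: "(a, b) \<in> R" "f x = f a" "f y = f b" by auto
    with sub have "a \<in> M \<union> K" "b \<in> M \<union> K" by blast+
    with ab that inj have "x = a" "y = b" by (meson inj_onD)+
    with ab show "(x, y) \<in> R" by simp
  qed (auto intro: rev_image_eqI)
  have ex: "\<exists>x y. x \<in> M \<union> K \<and> y \<in> M \<union> K \<and> u = f x \<and> v = f y \<and> (x, y) \<in> R"
    if uv: "(u, v) \<in> ?S" for u v
  proof -
    obtain x y where "(x, y) \<in> R" "u = f x" "v = f y" using uv by auto
    with sub show ?thesis by blast
  qed
  have S_sub: "?S \<subseteq> (f ` M \<union> f ` K) \<times> (f ` M \<union> f ` K)"
    using ex by blast
  have S_refl: "refl_on (f ` M \<union> f ` K) ?S"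
    using rf iff unfolding refl_on_def by blast
  have S_trans: "trans ?S"
  proof (rule transI)
    fix u v w assume "(u, v) \<in> ?S" "(v, w) \<in> ?S"
    then obtain x y y' z where h: "x \<in> M \<union> K" "y \<in> M \<union> K" "u = f x" "v = f y" "(x, y) \<in> R"
      "y' \<in> M \<union> K" "z \<in> M \<union> K" "v = f y'" "w = f z" "(y', z) \<in> R"
      using ex by metis
    then have "y = y'" using inj by (metis inj_onD)
    then have "(x, z) \<in> R" using h tr by (meson transD)
    then show "(u, w) \<in> ?S" using h iff by simp
  qed
  have S_antisym: "antisym ?S"
  proof (rule antisymI)
    fix u v assume a: "(u, v) \<in> ?S" "(v, u) \<in> ?S"
    then obtain x y where h: "x \<in> M \<union> K" "y \<in> M \<union> K" "u = f x" "v = f y" "(x, y) \<in> R"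
      using ex by metis
    then have "(y, x) \<in> R" using a iff by simp
    then show "u = v" using h an by (metis antisymD)
  qed
  have "partial_order_on (f ` M \<union> f ` K) ?S"
    using S_sub S_refl S_trans S_antisym by (simp add: partial_order_on_def preorder_on_def)
  moreover have "Restr ?S (f ` K) = map_prod f f ` P"
  proof (intro subset_antisym subrelI)
    fix u v assume "(u, v) \<in> Restr ?S (f ` K)"
    then have "u \<in> f ` K" "v \<in> f ` K" and uv: "(u, v) \<in> ?S" by blast+
    from this(1,2) obtain x y where xy: "x \<in> K" "y \<in> K" "u = f x" "v = f y"
      by (elim imageE)
    with uv iff have "(x, y) \<in> R" by simp
    with xy rs have "(x, y) \<in> P" by blast
    then have "map_prod f f (x, y) \<in> map_prod f f ` P" by (rule imageI)
    with xy show "(u, v) \<in> map_prod f f ` P" by simp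
  next
    fix u v assume "(u, v) \<in> map_prod f f ` P"
    then obtain x y where "(x, y) \<in> P" "u = f x" "v = f y" by auto
    moreover from this P rs have "x \<in> K" "y \<in> K" "(x, y) \<in> R" by blast+
    ultimately show "(u, v) \<in> Restr ?S (f ` K)" using iff by simp
  qed
  moreover have "minimal_elements (f ` M \<union> f ` K) ?S = f ` M"
  proof -
    have feq: "f x = f y \<longleftrightarrow> x = y" if "x \<in> M \<union> K" "y \<in> M \<union> K" for x y
      using inj that by (meson inj_onD)
    have mem: "f x \<in> minimal_elements (f ` (M \<union> K)) ?S \<longleftrightarrow> x \<in> minimal_elements (M \<union> K) R"
      if "x \<in> M \<union> K" for x
      using that by (simp add: minimal_elements_def iff feq del: Un_iff)
    have "minimal_elements (f ` (M \<union> K)) ?S = f ` minimal_elements (M \<union> K) R"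
    proof (intro subset_antisym subsetI)
      fix u assume u: "u \<in> minimal_elements (f ` (M \<union> K)) ?S"
      then have "u \<in> f ` (M \<union> K)" by (simp add: minimal_elements_def)
      then obtain x where "x \<in> M \<union> K" "u = f x" by (elim imageE)
      with u mem show "u \<in> f ` minimal_elements (M \<union> K) R" by simp
    next
      fix u assume "u \<in> f ` minimal_elements (M \<union> K) R"
      then obtain x where x: "x \<in> minimal_elements (M \<union> K) R" "u = f x" by (elim imageE)
      then have "x \<in> M \<union> K" by (simp add: minimal_elements_def)
      with x mem show "u \<in> minimal_elements (f ` (M \<union> K)) ?S" by simp
    qed
    then show ?thesis by (simp add: mn image_Un)
  qed
  ultimately show ?thesis by (simp add: extensions_def)
qed

lemma card_extensions_image:
  assumes inj: "inj_on f (M \<union> K)" and P: "P \<subseteq> K \<times> K"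
  shows "card (extensions (f ` M) (f ` K) (map_prod f f ` P)) = card (extensions M K P)"
proof -
  define g where "g = inv_into (M \<union> K) f"
  have gf: "g (f x) = x" if "x \<in> M \<union> K" for x
    using inj that by (simp add: g_def)
  have fg: "f (g y) = y" if "y \<in> f ` M \<union> f ` K" for y
    using that by (metis g_def f_inv_into_f image_Un)
  have gM: "g ` f ` M = M" and gK: "g ` f ` K = K"
    using gf by (simp_all add: image_image cong: image_cong)
  have gfR: "map_prod g g ` map_prod f f ` R = R" if "R \<subseteq> (M \<union> K) \<times> (M \<union> K)" for R
  proof -
    have "(map_prod g g \<circ> map_prod f f) ` R = id ` R"
      using that gf by (intro image_cong) auto
    then show ?thesis by (simp add: image_comp)
  qed
  have fgS: "map_prod f f ` map_prod g g ` S = S"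
    if "S \<subseteq> (f ` M \<union> f ` K) \<times> (f ` M \<union> f ` K)" for S
  proof -
    have "(map_prod f f \<circ> map_prod g g) ` S = id ` S"
      using that fg by (intro image_cong) auto
    then show ?thesis by (simp add: image_comp)
  qed
  have g_inj: "inj_on g (f ` M \<union> f ` K)"
    by (metis fg inj_onI)
  have fP: "map_prod f f ` P \<subseteq> f ` K \<times> f ` K" using P by auto
  have gP: "map_prod g g ` map_prod f f ` P = P" by (rule gfR) (use P in blast)
  have "bij_betw ((`) (map_prod f f)) (extensions M K P)
      (extensions (f ` M) (f ` K) (map_prod f f ` P))"
  proof (rule bij_betw_byWitness[where f' = "(`) (map_prod g g)"])
    show "\<forall>R\<in>extensions M K P. map_prod g g ` map_prod f f ` R = R"
      by (intro ballI gfR extensions_subset)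
    show "\<forall>S\<in>extensions (f ` M) (f ` K) (map_prod f f ` P). map_prod f f ` map_prod g g ` S = S"
      by (intro ballI fgS extensions_subset)
    show "(`) (map_prod f f) ` extensions M K P \<subseteq> extensions (f ` M) (f ` K) (map_prod f f ` P)"
      using extensions_image[OF inj P] by (intro image_subsetI)
    show "(`) (map_prod g g) ` extensions (f ` M) (f ` K) (map_prod f f ` P) \<subseteq> extensions M K P"
      using extensions_image[OF g_inj fP] unfolding gM gK gP by (intro image_subsetI)
  qed
  then show ?thesis by (metis bij_betw_same_card)
qed

lemma num_extensions_eq:
  assumes "partial_order_on K P" and "finite M" and "M \<inter> K = {}" and "card M = m"
  shows "card (extensions M K P) = num_extensions m K P"
proof -
  obtain h where h: "bij_betw h M {..<m}"
    using assms(2,4) by (metis ex_bij_betw_finite_nat atLeast0LessThan)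
  define f :: "'a \<Rightarrow> 'a + nat" where "f = (\<lambda>x. if x \<in> K then Inl x else Inr (h x))"
  have P: "P \<subseteq> K \<times> K" using assms(1) by (rule partial_order_onD)
  have "inj_on f (M \<union> K)"
    using h by (auto simp: inj_on_def f_def bij_betw_def)
  moreover have "f ` K = Inl ` K" by (auto simp: f_def)
  moreover have "f ` M = Inr ` {..<m}"
  proof -
    have "f ` M = Inr ` h ` M"
      unfolding image_image using assms(3) by (intro image_cong) (auto simp: f_def)
    then show ?thesis using h by (simp add: bij_betw_def)
  qed
  moreover have "map_prod f f ` P = map_prod Inl Inl ` P"
    using P by (intro image_cong) (auto simp: f_def)
  ultimately show ?thesis
    using card_extensions_image[of f M K P] P by (simp add: num_extensions_def)
qed

end

theory Submission
  imports Defs "HOL-Library.FuncSet"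
begin

text \<open>
  An extension is determined by the downsets \<open>f i = {y \<in> K. \<not> i \<le> y}\<close> of the points \<open>i \<in> M\<close>, and a
  family \<open>f\<close> of downsets arises in this way iff no element of \<open>K\<close> lies in all \<open>f i\<close>. The deficit
  therefore counts the families of downsets with nonempty intersection. Such an intersection contains
  a minimal element \<open>p\<close>, and deleting \<open>p\<close> embeds the downsets containing \<open>p\<close> into the downsets of
  \<open>K - {p}\<close>; so the deficit is at most \<open>m(P) d'(P)^m\<close>, and \<open>n \<le> 2^(n-1)\<close>.

  For \<open>A\<close> a proper subset of \<open>K\<close>, taking down-closures embeds the downsets of \<open>A\<close> into those of \<open>K\<close>,
  and misses the principal downset of any \<open>p \<in> K - A\<close>. Hence \<open>d'(P) < d(P)\<close>.
\<close>

section \<open>Downset counts of a poset and of its proper subposets\<close>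

lemma finite_downsets: "finite K \<Longrightarrow> finite (downsets K P)"
  by (rule finite_subset[of _ "Pow K"]) (auto simp: downsets_def)

lemma num_downsets_le: "finite K \<Longrightarrow> num_downsets K P \<le> 2 ^ card K"
  unfolding num_downsets_def
  by (subst card_Pow[symmetric], assumption, rule card_mono) (auto simp: downsets_def)

lemma num_downsets_pos: "finite K \<Longrightarrow> 0 < num_downsets K P"
  unfolding num_downsets_def using finite_downsets[of K P]
  by (auto simp: card_gt_0_iff downsets_def)

lemma num_downsets_Restr_less:
  assumes "finite K" and po: "partial_order_on K P" and A: "A \<subset> K"
  shows "num_downsets A (Restr P A) < num_downsets K P"
proof -
  define c where "c D = {x \<in> K. \<exists>y\<in>D. (x, y) \<in> P}" for D
  have rf: "refl_on K P" and tr: "trans P" and an: "antisym P"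
    using partial_order_onD[OF po] by auto
  obtain p where p: "p \<in> K" "p \<notin> A" using A by blast
  have c_in: "c D \<in> downsets K P" for D
    unfolding c_def downsets_def using tr by (blast dest: transD)
  \<comment> \<open>\<open>D\<close> is already down-closed inside \<open>A\<close>, so its closure
    in \<open>K\<close> adds only points outside \<open>A\<close>; cutting back to \<open>A\<close>
    thus inverts \<open>c\<close>.\<close>
  have "c D \<inter> A = D" if "D \<in> downsets A (Restr P A)" for D
    using that A rf unfolding c_def downsets_def refl_on_def by blast
  then have "inj_on c (downsets A (Restr P A))"
    by (metis inj_onI)
  \<comment> \<open>Equality would put \<open>p\<close> below some \<open>y\<close> in
    \<open>D\<close> and that \<open>y\<close> below \<open>p\<close>; antisymmetry then forces
    \<open>p\<close> into \<open>A\<close>.\<close>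
  moreover have "c {p} \<notin> c ` downsets A (Restr P A)"
  proof
    assume "c {p} \<in> c ` downsets A (Restr P A)"
    then obtain D where D: "D \<subseteq> A" "c {p} = c D"
      by (auto simp: downsets_def)
    have "p \<in> c {p}" using p rf by (auto simp: c_def refl_on_def)
    then obtain y where y: "y \<in> D" "(p, y) \<in> P" using D by (auto simp: c_def)
    have "y \<in> c D" using y D A rf unfolding c_def refl_on_def by blast
    then have "(y, p) \<in> P" using D by (auto simp: c_def)
    then have "y = p" using y an by (meson antisymD)
    then show False using y D p by blast
  qed
  ultimately show ?thesis
    unfolding num_downsets_def
    by (metis (no_types, lifting) c_in card_image finite_downsets[OF assms(1)] image_subsetI
        psubset_card_mono psubsetI)
qed

lemma finite_proper_downset_numbers:
  "finite K \<Longrightarrow> finite {num_downsets A (Restr P A) | A. A \<subset> K}"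
  by (rule finite_subset[of _ "(\<lambda>A. num_downsets A (Restr P A)) ` Pow K"]) auto

lemma num_downsets_le_max:
  "finite K \<Longrightarrow> A \<subset> K \<Longrightarrow> num_downsets A (Restr P A) \<le> max_proper_downsets K P"
  unfolding max_proper_downsets_def by (rule Max_ge[OF finite_proper_downset_numbers]) auto

text \<open>A nonempty \<open>K\<close> has the empty set as a proper subset, so \<open>Max\<close>
  ranges over a nonempty finite set.\<close>

lemma max_proper_downsets_attained:
  assumes "finite K" and "K \<noteq> {}"
  obtains A where "A \<subset> K" and "max_proper_downsets K P = num_downsets A (Restr P A)"
proof -
  have "max_proper_downsets K P \<in> {num_downsets A (Restr P A) | A. A \<subset> K}"
    unfolding max_proper_downsets_def
    using assms by (intro Max_in finite_proper_downset_numbers) auto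
  then show ?thesis using that by blast
qed

lemma max_proper_downsets_le:
  assumes "finite K" and "K \<noteq> {}"
  shows "max_proper_downsets K P \<le> 2 ^ (card K - 1)"
proof -
  obtain A where A: "A \<subset> K" "max_proper_downsets K P = num_downsets A (Restr P A)"
    using max_proper_downsets_attained[OF assms] .
  have "card A < card K" using A assms by (simp add: psubset_card_mono)
  then have "(2::nat) ^ card A \<le> 2 ^ (card K - 1)" by (intro power_increasing) auto
  then show ?thesis
    using A num_downsets_le[of A] assms finite_subset[of A K] by (metis order_trans psubsetE)
qed

lemma max_proper_downsets_less:
  "finite K \<Longrightarrow> K \<noteq> {} \<Longrightarrow> partial_order_on K P \<Longrightarrow> max_proper_downsets K P < num_downsets K P"
  by (metis max_proper_downsets_attained num_downsets_Restr_less)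

section \<open>Minimal elements and the downsets through them\<close>

lemma minimal_element_below:
  assumes "finite K" and po: "partial_order_on K P" and "x \<in> K"
  obtains p where "p \<in> minimal_elements K P" and "(p, x) \<in> P"
proof -
  have rf: "refl_on K P" and tr: "trans P" and an: "antisym P"
    using partial_order_onD[OF po] by auto
  have "\<exists>p\<in>minimal_elements K P. (p, x) \<in> P"
    using \<open>x \<in> K\<close>
  \<comment> \<open>The measure is the size of the principal downset: passing to a strictly smaller
    \<open>y\<close> removes at least \<open>x\<close> from it.\<close>
  proof (induction "card {y \<in> K. (y, x) \<in> P}" arbitrary: x rule: less_induct)
    case less
    show ?case
    proof (cases "x \<in> minimal_elements K P")
      case True
      then show ?thesis using rf less.prems by (auto simp: refl_on_def)
    next
      case False
      then obtain y where y: "y \<in> K" "(y, x) \<in> P" "y \<noteq> x"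
        using less.prems by (auto simp: minimal_elements_def)
      have "{z \<in> K. (z, y) \<in> P} \<subseteq> {z \<in> K. (z, x) \<in> P}"
        using y tr by (blast dest: transD)
      moreover have "x \<in> {z \<in> K. (z, x) \<in> P}" "x \<notin> {z \<in> K. (z, y) \<in> P}"
        using y an rf less.prems by (auto simp: refl_on_def dest: antisymD)
      ultimately have "card {z \<in> K. (z, y) \<in> P} < card {z \<in> K. (z, x) \<in> P}"
        using \<open>finite K\<close> by (intro psubset_card_mono) auto
      then obtain p where "p \<in> minimal_elements K P" "(p, y) \<in> P"
        using less.hyps y by blast
      then show ?thesis using y tr by (blast dest: transD)
    qed
  qed
  then show ?thesis using that by blast
qed

lemma card_downsets_through_minimal_le:
  assumes "finite K" and p: "p \<in> minimal_elements K P"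
  shows "card {D \<in> downsets K P. p \<in> D} \<le> max_proper_downsets K P"
proof -
  let ?A = "K - {p}"
  \<comment> \<open>All sets of this family contain \<open>p\<close>, so deleting it loses no
    information.\<close>
  have "inj_on (\<lambda>D. D - {p}) {D \<in> downsets K P. p \<in> D}"
    by (rule inj_onI) blast
  moreover have "(\<lambda>D. D - {p}) ` {D \<in> downsets K P. p \<in> D} \<subseteq> downsets ?A (Restr P ?A)"
    by (auto simp: downsets_def)
  ultimately have "card {D \<in> downsets K P. p \<in> D} \<le> num_downsets ?A (Restr P ?A)"
    unfolding num_downsets_def using assms(1) by (intro card_inj_on_le finite_downsets) auto
  also have "\<dots> \<le> max_proper_downsets K P"
    using p assms(1) by (intro num_downsets_le_max) (auto simp: minimal_elements_def)
  finally show ?thesis .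
qed

section \<open>Extensions as covering families of downsets\<close>

text \<open>The new points must all be minimal, so they form an antichain with nothing from
  \<open>K\<close> below them. Only the pairs from new points to \<open>K\<close> are free; they are
  stored through complements.\<close>

definition downset_extension :: "nat \<Rightarrow> 'a set \<Rightarrow> 'a rel \<Rightarrow> (nat \<Rightarrow> 'a set) \<Rightarrow> ('a + nat) rel" where
  "downset_extension m K P f =
     map_prod Inl Inl ` P \<union> Id_on (Inr ` {..<m}) \<union> {(Inr i, Inl y) | i y. i < m \<and> y \<in> K - f i}"

lemma downset_extension_simps [simp]:
  "(Inl x, Inl y) \<in> downset_extension m K P f \<longleftrightarrow> (x, y) \<in> P"
  "(Inr i, Inl y) \<in> downset_extension m K P f \<longleftrightarrow> i < m \<and> y \<in> K - f i"
  "(Inr i, Inr j) \<in> downset_extension m K P f \<longleftrightarrow> i < m \<and> i = j"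
  "(Inl x, Inr j) \<notin> downset_extension m K P f"
  by (auto simp: downset_extension_def)

lemma downset_extension_in_extensions:
  assumes po: "partial_order_on K P" and f: "f \<in> {..<m} \<rightarrow> downsets K P"
    and cover: "\<forall>p\<in>K. \<exists>i<m. p \<notin> f i"
  shows "downset_extension m K P f \<in> extensions (Inr ` {..<m}) (Inl ` K) (map_prod Inl Inl ` P)"
proof -
  let ?R = "downset_extension m K P f"
  let ?N = "Inr ` {..<m} \<union> Inl ` K :: ('a + nat) set"
  have sub: "P \<subseteq> K \<times> K" and rf: "refl_on K P" and tr: "trans P" and an: "antisym P"
    using partial_order_onD[OF po] by auto
  \<comment> \<open>Complements of downsets are upward closed; this is the mixed case of
    transitivity, from a new point through two points of \<open>K\<close>.\<close>
  have up: "y \<notin> f i" if "i < m" "x \<in> K" "x \<notin> f i" "(x, y) \<in> P" for i x y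
    using that f by (auto simp: downsets_def Pi_iff)
  have mem: "y \<in> K" if "(x, y) \<in> P" for x y
    using that sub by blast
  have "?R \<subseteq> ?N \<times> ?N"
    using sub by (auto simp: downset_extension_def)
  moreover have "refl_on ?N ?R"
    using rf by (auto simp: refl_on_def)
  moreover have "trans ?R"
  proof (rule transI)
    fix u v w assume "(u, v) \<in> ?R" "(v, w) \<in> ?R"
    then show "(u, w) \<in> ?R"
      by (cases u; cases v; cases w) (auto intro: transD[OF tr] dest: up mem)
  qed
  moreover have "antisym ?R"
  proof (rule antisymI)
    fix u v assume "(u, v) \<in> ?R" "(v, u) \<in> ?R"
    then show "u = v" using an by (cases u; cases v) (auto dest: antisymD)
  qed
  ultimately have "partial_order_on ?N ?R"
    by (simp add: partial_order_on_def preorder_on_def)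
  moreover have "Restr ?R (Inl ` K) = map_prod Inl Inl ` P"
    using sub by (auto simp: downset_extension_def)
  moreover have "minimal_elements ?N ?R = Inr ` {..<m}"
  proof (intro subset_antisym subsetI)
    fix u assume u: "u \<in> minimal_elements ?N ?R"
    show "u \<in> Inr ` {..<m}"
    proof (cases u)
      case (Inl p)
      then have "p \<in> K" using u by (auto simp: minimal_elements_def)
      \<comment> \<open>By the covering condition a new point lies below \<open>p\<close>, so no
        element of \<open>K\<close> is minimal.\<close>
      then obtain i where "i < m" "p \<notin> f i" using cover by blast
      then have "Inr i \<in> ?N" "(Inr i, u) \<in> ?R" using Inl \<open>p \<in> K\<close> by auto
      then have "Inr i = u" using u unfolding minimal_elements_def by blast
      then show ?thesis using Inl by simp
    qed (use u in \<open>auto simp: minimal_elements_def\<close>)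
  qed (auto simp: minimal_elements_def)
  ultimately show ?thesis by (simp add: extensions_def)
qed

text \<open>Restricting to indices below \<open>m\<close> fixes the other values as
  \<open>undefined\<close>, so that an extension yields exactly one family in the extensional
  function space.\<close>

definition extension_downsets :: "nat \<Rightarrow> 'a set \<Rightarrow> ('a + nat) rel \<Rightarrow> nat \<Rightarrow> 'a set" where
  "extension_downsets m K R = (\<lambda>i\<in>{..<m}. {y \<in> K. (Inr i, Inl y) \<notin> R})"

text \<open>What covers \<open>K\<close> is the family of complements \<open>K - f i\<close>;
  equivalently, the sets \<open>f i\<close> have no common element in \<open>K\<close>.\<close>

definition covering_families :: "nat \<Rightarrow> 'a set \<Rightarrow> 'a rel \<Rightarrow> (nat \<Rightarrow> 'a set) set" where
  "covering_families m K P = {f \<in> {..<m} \<rightarrow>\<^sub>E downsets K P. \<forall>p\<in>K. \<exists>i<m. p \<notin> f i}"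

text \<open>These are the two facts that make \<open>extension_downsets\<close> a right inverse of
  \<open>downset_extension\<close>. Transitivity of \<open>R\<close> makes the sets downsets, and
  minimality of the new points rules out all pairs that \<open>downset_extension\<close>
  omits.\<close>

lemma
  assumes "finite K" and sub: "P \<subseteq> K \<times> K"
    and R: "R \<in> extensions (Inr ` {..<m}) (Inl ` K) (map_prod Inl Inl ` P)"
  shows extension_downsets_covering: "extension_downsets m K R \<in> covering_families m K P"
    and downset_extension_downsets: "downset_extension m K P (extension_downsets m K R) = R"
proof -
  let ?N = "Inr ` {..<m} \<union> Inl ` K :: ('a + nat) set"
  have po: "partial_order_on ?N R" and rs: "Restr R (Inl ` K) = map_prod Inl Inl ` P"
    and mn: "minimal_elements ?N R = Inr ` {..<m}"
    using R by (auto simp: extensions_def)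
  have R_sub: "R \<subseteq> ?N \<times> ?N" and rf: "refl_on ?N R" and tr: "trans R"
    using partial_order_onD[OF po] by auto
  have P_iff: "(x, y) \<in> P \<longleftrightarrow> (Inl x, Inl y) \<in> R" if "x \<in> K" "y \<in> K" for x y
  proof -
    have "(x, y) \<in> P \<longleftrightarrow> (Inl x :: 'a + nat, Inl y :: 'a + nat) \<in> map_prod Inl Inl ` P"
      by auto
    also have "\<dots> \<longleftrightarrow> (Inl x, Inl y) \<in> R" using that unfolding rs[symmetric] by simp
    finally show ?thesis .
  qed
  have minD: "u = Inr i" if "(u, Inr i) \<in> R" for u i
  proof -
    have "u \<in> ?N" "Inr i \<in> minimal_elements ?N R" using that R_sub unfolding mn by auto
    then show ?thesis using that unfolding minimal_elements_def by blast
  qed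
  have "extension_downsets m K R i \<in> downsets K P" if "i < m" for i
    using that P_iff tr by (auto simp: extension_downsets_def downsets_def dest: transD)
  moreover have "\<exists>i<m. p \<notin> extension_downsets m K R i" if p: "p \<in> K" for p
  proof -
    \<comment> \<open>Below \<open>Inl p\<close> there is a minimal element of the whole order
      \<open>R\<close>, and this must be one of the new points.\<close>
    have "finite ?N" "Inl p \<in> ?N" using assms(1) p by auto
    then obtain u where "u \<in> minimal_elements ?N R" "(u, Inl p) \<in> R"
      using minimal_element_below po by metis
    then show ?thesis unfolding mn by (auto simp: extension_downsets_def)
  qed
  ultimately show "extension_downsets m K R \<in> covering_families m K P"
    by (auto simp: covering_families_def extension_downsets_def)
  have "(u, v) \<in> downset_extension m K P (extension_downsets m K R) \<longleftrightarrow> (u, v) \<in> R" for u v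
  proof (cases u; cases v)
    fix x y assume "u = Inl x" "v = Inl y"
    then show ?thesis using P_iff sub R_sub by auto
  next
    fix i y assume "u = Inr i" "v = Inl y"
    then show ?thesis using R_sub by (auto simp: extension_downsets_def)
  next
    fix x j assume "u = Inl x" "v = Inr j"
    then show ?thesis using minD by auto
  next
    fix i j assume "u = Inr i" "v = Inr j"
    then show ?thesis using minD R_sub rf by (auto simp: refl_on_def)
  qed
  then show "downset_extension m K P (extension_downsets m K R) = R" by auto
qed

lemma num_extensions_eq_card_covering:
  assumes "finite K" and po: "partial_order_on K P"
  shows "num_extensions m K P = card (covering_families m K P)"
proof -
  have sub: "P \<subseteq> K \<times> K" using po by (rule partial_order_onD)
  have "bij_betw (downset_extension m K P) (covering_families m K P)
      (extensions (Inr ` {..<m}) (Inl ` K) (map_prod Inl Inl ` P))"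
  proof (rule bij_betw_byWitness[where f' = "extension_downsets m K"])
    show "\<forall>f\<in>covering_families m K P. extension_downsets m K (downset_extension m K P f) = f"
    proof
      fix f assume f: "f \<in> covering_families m K P"
      show "extension_downsets m K (downset_extension m K P f) = f"
      proof
        fix i
        show "extension_downsets m K (downset_extension m K P f) i = f i"
        proof (cases "i < m")
          case True
          \<comment> \<open>Inside \<open>K\<close> the double complement of \<open>f i\<close> is
            \<open>f i\<close> itself.\<close>
          then have "f i \<subseteq> K"
            using f by (auto simp: covering_families_def downsets_def PiE_iff)
          then show ?thesis using True by (auto simp: extension_downsets_def)
        next
          case False
          then show ?thesis
            using f by (auto simp: extension_downsets_def covering_families_def PiE_iff extensional_def)
        qed
      qed
    qed
    show "downset_extension m K P ` covering_families m K P
        \<subseteq> extensions (Inr ` {..<m}) (Inl ` K) (map_prod Inl Inl ` P)"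
      by (auto simp: covering_families_def intro!: downset_extension_in_extensions[OF po])
  qed (use extension_downsets_covering[OF assms(1) sub] downset_extension_downsets[OF assms(1) sub]
      in auto)
  then show ?thesis by (simp add: num_extensions_def bij_betw_same_card)
qed

section \<open>Bounds on the deficit\<close>

lemma num_extensions_bounds:
  assumes "finite K" and po: "partial_order_on K P"
  shows "num_extensions m K P \<le> num_downsets K P ^ m"
    and "num_downsets K P ^ m
      \<le> num_extensions m K P + num_minimal K P * max_proper_downsets K P ^ m"
proof -
  let ?F = "{..<m} \<rightarrow>\<^sub>E downsets K P"
  let ?G = "\<lambda>p. {..<m} \<rightarrow>\<^sub>E {D \<in> downsets K P. p \<in> D}"
  let ?Mn = "minimal_elements K P"
  have fin: "finite ?F" using assms(1) by (intro finite_PiE finite_downsets) auto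
  have card_F: "card ?F = num_downsets K P ^ m"
    by (simp add: card_PiE num_downsets_def)
  have cov: "covering_families m K P \<subseteq> ?F" by (auto simp: covering_families_def)
  show "num_extensions m K P \<le> num_downsets K P ^ m"
    unfolding num_extensions_eq_card_covering[OF assms] card_F[symmetric]
    using fin cov by (rule card_mono)
  have fin_Mn: "finite ?Mn" using assms(1) by (simp add: minimal_elements_def)
  have fin_G: "finite (?G p)" for p
    using finite_downsets[OF assms(1)] by (intro finite_PiE) auto
  \<comment> \<open>A family that fails to cover has a common element \<open>x\<close>; being
    downsets, its members also share any minimal \<open>p\<close> below \<open>x\<close>. A union
    bound over the minimal elements follows.\<close>
  have "?F \<subseteq> covering_families m K P \<union> (\<Union>p\<in>?Mn. ?G p)"
  proof
    fix f assume f: "f \<in> ?F"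
    show "f \<in> covering_families m K P \<union> (\<Union>p\<in>?Mn. ?G p)"
    proof (cases "f \<in> covering_families m K P")
      case False
      then obtain x where x: "x \<in> K" "\<forall>i<m. x \<in> f i"
        using f by (auto simp: covering_families_def)
      obtain p where p: "p \<in> ?Mn" "(p, x) \<in> P"
        using minimal_element_below[OF assms x(1)] .
      then have "p \<in> K" by (simp add: minimal_elements_def)
      then have "p \<in> f i" if "i < m" for i
        using that p x f by (auto simp: PiE_iff downsets_def)
      then have "f \<in> ?G p" using f by (auto simp: PiE_iff)
      then show ?thesis using p by blast
    qed simp
  qed
  then have "card ?F \<le> card (covering_families m K P \<union> (\<Union>p\<in>?Mn. ?G p))"
    using fin_Mn fin_G finite_subset[OF cov fin] by (intro card_mono) auto
  also have "\<dots> \<le> card (covering_families m K P) + card (\<Union>p\<in>?Mn. ?G p)"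
    by (rule card_Un_le)
  also have "card (\<Union>p\<in>?Mn. ?G p) \<le> (\<Sum>p\<in>?Mn. card (?G p))"
    using fin_Mn by (rule card_UN_le)
  also have "\<dots> \<le> (\<Sum>p\<in>?Mn. max_proper_downsets K P ^ m)"
    using card_downsets_through_minimal_le[OF assms(1)]
    by (intro sum_mono) (auto simp: card_PiE intro!: power_mono)
  also have "\<dots> = num_minimal K P * max_proper_downsets K P ^ m"
    by (simp add: num_minimal_def)
  finally show "num_downsets K P ^ m
      \<le> num_extensions m K P + num_minimal K P * max_proper_downsets K P ^ m"
    by (simp add: card_F num_extensions_eq_card_covering[OF assms])
qed

lemma extension_deficit_nonneg:
  assumes "finite K" and "partial_order_on K P"
  shows "0 \<le> extension_deficit m K P"
  using num_extensions_bounds(1)[OF assms, of m]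
  by (simp add: extension_deficit_def flip: of_nat_power)

lemma extension_deficit_le:
  assumes "finite K" and "partial_order_on K P"
  shows "extension_deficit m K P \<le> 2 ^ (num_minimal K P - 1) * int (max_proper_downsets K P) ^ m"
proof -
  \<comment> \<open>This trades the factor m(P) for the stated power of two. With truncated
    subtraction it also holds at \<open>n = 0\<close>, where the right side is 1.\<close>
  have "n \<le> 2 ^ (n - 1)" for n :: nat
    using less_exp[of "n - 1"] by (cases n) (auto simp: Suc_le_eq)
  then have "num_minimal K P * max_proper_downsets K P ^ m
      \<le> 2 ^ (num_minimal K P - 1) * max_proper_downsets K P ^ m"
    by (rule mult_right_mono) simp
  then have "num_downsets K P ^ m
      \<le> num_extensions m K P + 2 ^ (num_minimal K P - 1) * max_proper_downsets K P ^ m"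
    using num_extensions_bounds(2)[OF assms, of m] by linarith
  then have "int (num_downsets K P ^ m)
      \<le> int (num_extensions m K P + 2 ^ (num_minimal K P - 1) * max_proper_downsets K P ^ m)"
    by (rule of_nat_mono)
  then show ?thesis by (simp add: extension_deficit_def)
qed

lemma deficit_bound_le:
  assumes "finite K" and "K \<noteq> {}"
  shows "2 ^ (num_minimal K P - 1) * max_proper_downsets K P ^ m \<le> 2 ^ ((card K - 1) * (m + 1))"
proof -
  have "num_minimal K P \<le> card K"
    unfolding num_minimal_def using assms(1) by (intro card_mono) (auto simp: minimal_elements_def)
  then have "(2::nat) ^ (num_minimal K P - 1) \<le> 2 ^ (card K - 1)"
    by (intro power_increasing) auto
  moreover have "max_proper_downsets K P ^ m \<le> (2 ^ (card K - 1)) ^ m"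
    using max_proper_downsets_le[OF assms] by (rule power_mono) simp
  ultimately have "2 ^ (num_minimal K P - 1) * max_proper_downsets K P ^ m
      \<le> 2 ^ (card K - 1) * (2 ^ (card K - 1)) ^ m"
    by (rule mult_mono) auto
  also have "\<dots> = 2 ^ ((card K - 1) * (m + 1))"
    by (simp add: power_mult power_add)
  finally show ?thesis .
qed

theorem theorem6p2:
  fixes K :: "'a set" and P :: "'a rel" and k :: nat
  assumes "finite K" and "K \<noteq> {}" and "card K = k" and "partial_order_on K P"
  shows "max_proper_downsets K P \<le> 2 ^ (k - 1)
    \<and> downset_ratio K P < 1
    \<and> (\<forall>m::nat. m > 0 \<longrightarrow>
          0 \<le> extension_deficit m K P
        \<and> extension_deficit m K P
            \<le> 2 ^ (num_minimal K P - 1) * int (max_proper_downsets K P) ^ m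
        \<and> (2::int) ^ (num_minimal K P - 1) * int (max_proper_downsets K P) ^ m
            \<le> 2 ^ ((k - 1) * (m + 1)))
    \<and> (\<exists>h. h \<in> O(\<lambda>m. downset_ratio K P ^ m)
        \<and> (\<forall>m. real (num_extensions m K P) = real (num_downsets K P) ^ m * (1 - h m)))
    \<and> (\<lambda>m. real (num_extensions m K P)) \<sim>[at_top] (\<lambda>m. real (num_downsets K P) ^ m)"
proof -
  let ?d = "real (num_downsets K P)" and ?d' = "real (max_proper_downsets K P)"
  let ?c = "2 ^ (num_minimal K P - 1) :: real" and ?\<epsilon> = "downset_ratio K P"
  have d: "?d > 0" using num_downsets_pos[OF assms(1)] by simp
  have ratio: "?\<epsilon> < 1"
    using max_proper_downsets_less[OF assms(1,2,4)] d by (simp add: downset_ratio_def)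
  have ratio_nonneg: "0 \<le> ?\<epsilon>" by (simp add: downset_ratio_def)
  have bound: "(2::int) ^ (num_minimal K P - 1) * int (max_proper_downsets K P) ^ m
      \<le> 2 ^ ((k - 1) * (m + 1))" for m
    using of_nat_mono[OF deficit_bound_le[OF assms(1,2), of P m], where 'a = int] assms(3)
    by simp
  \<comment> \<open>The witness for the error term is the deficit relative to d(P)^m.\<close>
  define h where "h m = real_of_int (extension_deficit m K P) / ?d ^ m" for m
  have h_nonneg: "0 \<le> h m" for m
    using extension_deficit_nonneg[OF assms(1,4), of m] by (simp add: h_def)
  have h_le: "h m \<le> ?c * ?\<epsilon> ^ m" for m
  proof -
    have "real_of_int (extension_deficit m K P)
        \<le> real_of_int (2 ^ (num_minimal K P - 1) * int (max_proper_downsets K P) ^ m)"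
      using extension_deficit_le[OF assms(1,4)] of_int_le_iff by blast
    then have "real_of_int (extension_deficit m K P) \<le> ?c * ?d' ^ m" by simp
    then have "h m \<le> ?c * ?d' ^ m / ?d ^ m"
      unfolding h_def by (rule divide_right_mono) simp
    then show ?thesis by (simp add: downset_ratio_def power_divide)
  qed
  have h_eq: "real (num_extensions m K P) = ?d ^ m * (1 - h m)" for m
    using d by (simp add: h_def extension_deficit_def field_simps)
  \<comment> \<open>The constant \<open>?c\<close> depends on \<open>P\<close> alone, not on
    \<open>m\<close>.\<close>
  have h_bigo: "h \<in> O(\<lambda>m. ?\<epsilon> ^ m)"
    using h_nonneg h_le ratio_nonneg by (intro bigoI[of _ ?c] always_eventually) simp
  \<comment> \<open>Since the ratio lies in [0, 1), \<open>h\<close> is squeezed between 0 and a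
    null geometric sequence.\<close>
  have "h \<longlonglongrightarrow> 0"
  proof (rule tendsto_sandwich[of "\<lambda>_. 0" _ _ "\<lambda>m. ?c * ?\<epsilon> ^ m"])
    show "(\<lambda>m. ?c * ?\<epsilon> ^ m) \<longlonglongrightarrow> 0"
      using ratio ratio_nonneg by (intro tendsto_mult_right_zero LIMSEQ_realpow_zero)
  qed (use h_nonneg h_le in auto)
  then have "(\<lambda>m. 1 - h m) \<longlonglongrightarrow> 1 - 0" by (intro tendsto_intros)
  \<comment> \<open>The quotient of the two sides is \<open>1 - h m\<close>, as d(P) is
    positive.\<close>
  then have "(\<lambda>m. real (num_extensions m K P)) \<sim>[at_top] (\<lambda>m. ?d ^ m)"
    using d by (intro asymp_equivI') (simp add: h_eq)
  then show ?thesis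
    using max_proper_downsets_le[OF assms(1,2), of P] assms(3) ratio bound h_bigo h_eq
      extension_deficit_nonneg[OF assms(1,4)] extension_deficit_le[OF assms(1,4)]
    by blast
qed

end
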